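(* For every graph $G$, the following statements are equivalent: (i) The graph $G$ is total domishold. (ii) The neighborhood function $f_G$ of $G$ is threshold. (iii) The Boolean function $f:\{0,1\}^{V(G)}\to\{0,1\}$ given by the complete DNF $\phi$ of $f_G$ is threshold. (iv) The hypergraph $\mathcal{H}(\phi)$ (where $\phi$ is the complete DNF of $f_G$) is threshold. (v) The reduced neighborhood hypergraph $\mathcal{RN}(G)$ of $G$ is threshold. (vi) The split-incidence graph $SI(\mathcal{RN}(G))$ of $\mathcal{RN}(G)$ is total domishold. (vii) The graph $S(G)$ is total domishold.
   Context: Graphs are finite, simple and undirected; $N_G(v)$ is the open neighborhood of $v$; $\mathbb{R}_+$ is the set of non-negative reals; $\subset$ denotes strict inclusion. A total dominating set in $G=(V,E)$ is a set $D\subseteq V$ such that every vertex of $G$ has a neighbor in $D$. $G$ is total domishold if there exist $w:V\to\mathbb{R}_+$ and $t\in\mathbb{R}_+$ such that for every $S\subseteq V$, $w(S):=\sum_{x\in S}w(x)\ge t$ if and only if $S$ is a total dominating set in $G$ (isolated vertices are allowed). The neighborhood function of $G=(V,E)$ is $f_G:\{0,1\}^V\to\{0,1\}$, $f_G(x)=\bigvee_{v\in V}\bigwedge_{u\in N_G(v)}x_u$ (an empty conjunction equals $1$). It is positive (monotone). The complete DNF of a positive Boolean function is the disjunction of all its prime implicants (the minimal conjunctions of variables implying $f$). A positive Boolean function $f$ on a finite set $V$ of variables is threshold if there exist non-negative real weights $(w_v)_{v\in V}$ and a real number $t$ such that for every $x\in\{0,1\}^V$: $f(x)=0$ if and only if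 $\sum_{v\in V} w_vx_v\le t$. A hypergraph is a pair $(\mathcal{V},\mathcal{E})$ with $\mathcal{V}$ a finite set and $\mathcal{E}$ a finite (multi)set of subsets of $\mathcal{V}$ (hyperedges). It is threshold if there exist $w:\mathcal{V}\to\mathbb{R}_+$ and a real $t$ such that for all $X\subseteq\mathcal{V}$: $w(X)\le t$ if and only if $X$ contains no hyperedge. For a positive DNF $\phi=\bigvee_{j=1}^m\bigwedge_{i\in C_j}x_i$ on a variable set indexed by $V$, $\mathcal{H}(\phi)$ is the hypergraph with vertex set $V$ and hyperedges $C_1,\ldots,C_m$. The reduced neighborhood hypergraph $\mathcal{RN}(G)$ has vertex set $V(G)$ and hyperedge set (without repetitions) $\{N_G(v)\mid v\in V(G),\ \text{there is no } u\in V(G)\setminus\{v\}\text{ with } N_G(u)\subset N_G(v)\}$. The split-incidence graph $SI(\mathcal{H})$ of a hypergraph $\mathcal{H}=(\mathcal{V},\mathcal{E})$ is the graph with vertex set $\mathcal{V}\cup\mathcal{E}'$ (disjoint), where $\mathcal{E}'=\{e'\mid e\in\mathcal{E}\}$ has one vertex per hyperedge, $\mathcal{V}$ is a clique, $\mathcal{E}'$ is an independent set, and $v\in\mathcal{V}$ is adjacent to $e'\in\mathcal{E}'$ if and only if $v\in e$. For $G=(V,E)$, $S(G)$ is the split graph with vertex set the disjoint union $V\cup W$, where $W=\{N_G(v)\mid v\in V,\ \text{there is no } u\in V\setminus\{v\}\text{ with } N_G(u)\subset N_G(v)\}$ (a set, without repetitions), $V$ is a clique, $W$ is an independent set, and $v\in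 V$ is adjacent to $X\in W$ if and only if $v\in X$. *)

theory Defs
  imports "Graph_Theory.Pair_Digraph" "HOL-Library.Multiset" "HOL-Library.FuncSet" Complex_Main
begin

text \<open>
  Finite simple undirected graphs are the instances of the locale \<^locale>\<open>pair_graph\<close>: a finite
  vertex set (possibly empty) and a symmetric, irreflexive set of arcs, an undirected edge being
  the pair of its two orientations.
\<close>

definition neighborhood :: "'a pair_pre_digraph \<Rightarrow> 'a \<Rightarrow> 'a set" where
  "neighborhood G v = {u \<in> pverts G. (v, u) \<in> parcs G}"

definition total_dominating_set :: "'a pair_pre_digraph \<Rightarrow> 'a set \<Rightarrow> bool" where
  "total_dominating_set G D \<longleftrightarrow>
     D \<subseteq> pverts G \<and> (\<forall>v \<in> pverts G. \<exists>u \<in> D. u \<in> neighborhood G v)"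

definition total_domishold :: "'a pair_pre_digraph \<Rightarrow> bool" where
  "total_domishold G \<longleftrightarrow>
     (\<exists>(w :: 'a \<Rightarrow> real) (t :: real).
        (\<forall>v \<in> pverts G. 0 \<le> w v) \<and> 0 \<le> t \<and>
        (\<forall>S \<subseteq> pverts G. (\<Sum>x\<in>S. w x) \<ge> t \<longleftrightarrow> total_dominating_set G S))"


subsection \<open>Positive Boolean functions\<close>

text \<open>
  The cube $\{0,1\}^V$ consists of the extensional functions from \<open>V\<close> to \<^typ>\<open>bool\<close>.  A Boolean
  function on \<open>V\<close> is a map of type \<open>('a \<Rightarrow> bool) \<Rightarrow> bool\<close>; only its values on the cube are ever
  used.
\<close>

definition bool_cube :: "'a set \<Rightarrow> ('a \<Rightarrow> bool) set" where
  "bool_cube V = V \<rightarrow>\<^sub>E (UNIV :: bool set)"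

definition positive_fun :: "'a set \<Rightarrow> (('a \<Rightarrow> bool) \<Rightarrow> bool) \<Rightarrow> bool" where
  "positive_fun V f \<longleftrightarrow>
     (\<forall>x \<in> bool_cube V. \<forall>y \<in> bool_cube V. (\<forall>v \<in> V. x v \<le> y v) \<longrightarrow> f x \<le> f y)"

text \<open>The threshold \<open>t\<close> may be negative, as it has to be for the constant function 1.\<close>

definition threshold_fun :: "'a set \<Rightarrow> (('a \<Rightarrow> bool) \<Rightarrow> bool) \<Rightarrow> bool" where
  "threshold_fun V f \<longleftrightarrow>
     positive_fun V f \<and>
     (\<exists>(w :: 'a \<Rightarrow> real) (t :: real).
        (\<forall>v \<in> V. 0 \<le> w v) \<and>
        (\<forall>x \<in> bool_cube V. \<not> f x \<longleftrightarrow> (\<Sum>v\<in>V. w v * of_bool (x v)) \<le> t))"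

definition neighborhood_fun :: "'a pair_pre_digraph \<Rightarrow> ('a \<Rightarrow> bool) \<Rightarrow> bool" where
  "neighborhood_fun G x \<longleftrightarrow> (\<exists>v \<in> pverts G. \<forall>u \<in> neighborhood G v. x u)"

text \<open>
  A conjunction of variables is represented by its set of variables, and a positive DNF by the
  finite multiset of its conjunctions.
\<close>

definition dnf_fun :: "'a set multiset \<Rightarrow> ('a \<Rightarrow> bool) \<Rightarrow> bool" where
  "dnf_fun \<phi> x \<longleftrightarrow> (\<exists>C \<in># \<phi>. \<forall>i \<in> C. x i)"

definition implicant :: "'a set \<Rightarrow> (('a \<Rightarrow> bool) \<Rightarrow> bool) \<Rightarrow> 'a set \<Rightarrow> bool" where
  "implicant V f C \<longleftrightarrow> C \<subseteq> V \<and> (\<forall>x \<in> bool_cube V. (\<forall>i \<in> C. x i) \<longrightarrow> f x)"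

definition prime_implicant :: "'a set \<Rightarrow> (('a \<Rightarrow> bool) \<Rightarrow> bool) \<Rightarrow> 'a set \<Rightarrow> bool" where
  "prime_implicant V f C \<longleftrightarrow> implicant V f C \<and> \<not> (\<exists>D. D \<subset> C \<and> implicant V f D)"

definition complete_dnf :: "'a set \<Rightarrow> (('a \<Rightarrow> bool) \<Rightarrow> bool) \<Rightarrow> 'a set multiset" where
  "complete_dnf V f = mset_set {C. prime_implicant V f C}"


subsection \<open>Hypergraphs\<close>

type_synonym 'a hypergraph = "'a set \<times> 'a set multiset"

definition wf_hypergraph :: "'a hypergraph \<Rightarrow> bool" where
  "wf_hypergraph H \<longleftrightarrow> finite (fst H) \<and> (\<forall>e \<in># snd H. e \<subseteq> fst H)"

definition threshold_hypergraph :: "'a hypergraph \<Rightarrow> bool" where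
  "threshold_hypergraph H \<longleftrightarrow>
     (\<exists>(w :: 'a \<Rightarrow> real) (t :: real).
        (\<forall>v \<in> fst H. 0 \<le> w v) \<and>
        (\<forall>X \<subseteq> fst H. (\<Sum>x\<in>X. w x) \<le> t \<longleftrightarrow> \<not> (\<exists>e \<in># snd H. e \<subseteq> X)))"

definition dnf_hypergraph :: "'a set \<Rightarrow> 'a set multiset \<Rightarrow> 'a hypergraph" where
  "dnf_hypergraph V \<phi> = (V, \<phi>)"

definition minimal_neighborhoods :: "'a pair_pre_digraph \<Rightarrow> 'a set set" where
  "minimal_neighborhoods G =
     {neighborhood G v | v. v \<in> pverts G \<and>
        \<not> (\<exists>u \<in> pverts G - {v}. neighborhood G u \<subset> neighborhood G v)}"

definition reduced_neighborhood_hypergraph :: "'a pair_pre_digraph \<Rightarrow> 'a hypergraph" where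
  "reduced_neighborhood_hypergraph G = (pverts G, mset_set (minimal_neighborhoods G))"


subsection \<open>Split graphs\<close>

definition split_graph_of :: "'a set \<Rightarrow> 'b set \<Rightarrow> ('a \<Rightarrow> 'b \<Rightarrow> bool) \<Rightarrow> ('a + 'b) pair_pre_digraph"
where
  "split_graph_of K I adj =
     \<lparr> pverts = Inl ` K \<union> Inr ` I,
       parcs = {(Inl u, Inl v) | u v. u \<in> K \<and> v \<in> K \<and> u \<noteq> v}
             \<union> {(Inl v, Inr y) | v y. v \<in> K \<and> y \<in> I \<and> adj v y}
             \<union> {(Inr y, Inl v) | v y. v \<in> K \<and> y \<in> I \<and> adj v y} \<rparr>"

text \<open>
  A hyperedge \<open>e\<close> of multiplicity \<open>m\<close> contributes the \<open>m\<close> distinct vertices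
  \<open>(e, 0), \<dots>, (e, m - 1)\<close> to the independent set.
\<close>

definition split_incidence_graph :: "'a hypergraph \<Rightarrow> ('a + 'a set \<times> nat) pair_pre_digraph" where
  "split_incidence_graph H =
     split_graph_of (fst H) {(e, i). i < count (snd H) e} (\<lambda>v (e, i). v \<in> e)"

definition neighborhood_split_graph :: "'a pair_pre_digraph \<Rightarrow> ('a + 'a set) pair_pre_digraph" where
  "neighborhood_split_graph G = split_graph_of (pverts G) (minimal_neighborhoods G) (\<in>)"


subsection \<open>Well-formedness\<close>

lemma positive_neighborhood_fun: "positive_fun (pverts G) (neighborhood_fun G)"
  unfolding positive_fun_def neighborhood_fun_def neighborhood_def by fastforce

lemma finite_prime_implicants:
  assumes "finite V"
  shows "finite {C. prime_implicant V f C}"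
  by (rule finite_subset[of _ "Pow V"]) (use assms in \<open>auto simp: prime_implicant_def implicant_def\<close>)

lemma wf_dnf_hypergraph_complete_dnf:
  assumes "finite V"
  shows "wf_hypergraph (dnf_hypergraph V (complete_dnf V f))"
  using assms finite_prime_implicants[OF assms, of f]
  by (auto simp: wf_hypergraph_def dnf_hypergraph_def complete_dnf_def prime_implicant_def
      implicant_def)

lemma finite_minimal_neighborhoods:
  assumes "pair_graph G"
  shows "finite (minimal_neighborhoods G)"
proof -
  interpret pair_graph G by fact
  have "minimal_neighborhoods G \<subseteq> neighborhood G ` pverts G"
    by (auto simp: minimal_neighborhoods_def)
  then show ?thesis using pair_finite_verts by (auto intro: finite_subset)
qed

lemma wf_reduced_neighborhood_hypergraph:
  assumes "pair_graph G"
  shows "wf_hypergraph (reduced_neighborhood_hypergraph G)"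
proof -
  interpret pair_graph G by fact
  show ?thesis
    using pair_finite_verts finite_minimal_neighborhoods[OF assms]
    by (auto simp: wf_hypergraph_def reduced_neighborhood_hypergraph_def minimal_neighborhoods_def
        neighborhood_def)
qed

lemma pair_graph_split_graph_of:
  assumes "finite K" "finite I"
  shows "pair_graph (split_graph_of K I adj)"
proof -
  let ?S = "split_graph_of K I adj"
  have fin: "finite (pverts ?S)" using assms by (simp add: split_graph_of_def)
  have sub: "parcs ?S \<subseteq> pverts ?S \<times> pverts ?S" by (auto simp: split_graph_of_def)
  have fin': "finite (parcs ?S)" by (rule finite_subset[OF sub]) (simp add: fin)
  show ?thesis
  proof
    show "symmetric (with_proj ?S)" unfolding symmetric_def
      by (auto simp: split_graph_of_def sym_def)
  qed (use fin fin' sub in \<open>auto simp: split_graph_of_def\<close>)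
qed

lemma pair_graph_split_incidence_graph:
  assumes "wf_hypergraph H"
  shows "pair_graph (split_incidence_graph H)"
proof -
  have "{(e, i). i < count (snd H) e} = (SIGMA e:set_mset (snd H). {..<count (snd H) e})"
    by (auto simp: count_greater_zero_iff[symmetric] simp del: count_greater_zero_iff)
  then show ?thesis
    using assms
    by (auto simp: split_incidence_graph_def wf_hypergraph_def intro!: pair_graph_split_graph_of)
qed

lemma pair_graph_neighborhood_split_graph:
  assumes "pair_graph G"
  shows "pair_graph (neighborhood_split_graph G)"
proof -
  interpret pair_graph G by fact
  show ?thesis
    using pair_finite_verts finite_minimal_neighborhoods[OF assms]
    by (simp add: neighborhood_split_graph_def pair_graph_split_graph_of)
qed

end

theory Submission
  imports Defs
begin

text \<open>
  All seven statements say that one and the same family of vertex sets can be cut off by a single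
  linear inequality.  Write $\mathcal{U}$ for the family of all $X \subseteq V(G)$ that contain some
  neighborhood $N_G(v)$; the predicate \<open>linearly_separable\<close> below says that non-negative weights and
  a bound separate such a family from its complement.  Each of the seven conditions turns out to be
  the linear separability of $\mathcal{U}$, for three different reasons.

  First, a set $S$ is a total dominating set if and only if it meets every neighborhood, that is, if
  and only if $V(G) \setminus S \notin \mathcal{U}$.  Complementation turns the inequality
  $w(S) \ge t$ into $w(V(G) \setminus S) \le w(V(G)) - t$, so total domishold graphs are those with
  separable $\mathcal{U}$ (\<open>total_domishold_iff_separable\<close>).

  Second, $\mathcal{U}$ is the set of true points of $f_G$.  It does not change if only the
  inclusion-minimal neighborhoods, or only the prime implicants, are kept, because by finiteness
  every neighborhood contains a minimal one and every implicant a prime one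
  (\<open>contains_minimal_neighborhood\<close>, \<open>dnf_fun_complete_dnf\<close>).

  Third, in a split graph in which no clique vertex is adjacent to all independent vertices, the
  total dominating sets are the sets whose clique part meets the neighborhood of every independent
  vertex: the clique vertices are then dominated automatically (\<open>total_dominating_split_graph\<close>).
  This applies to both split graphs built from $G$: since $v \notin N_G(v)$, every vertex $v$ is
  missed by some minimal neighborhood, namely one inside $N_G(v)$.
\<close>

section \<open>Linear separability of a family of sets\<close>

definition linearly_separable :: "'a set \<Rightarrow> ('a set \<Rightarrow> bool) \<Rightarrow> bool" where
  "linearly_separable V P \<longleftrightarrow>
     (\<exists>(w :: 'a \<Rightarrow> real) (t :: real).
        (\<forall>v \<in> V. 0 \<le> w v) \<and> (\<forall>X \<subseteq> V. (\<Sum>x\<in>X. w x) \<le> t \<longleftrightarrow> \<not> P X))"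

text \<open>
  The same weights serve on both sides; the bounds are related by \<open>t \<mapsto> w(V) - t\<close>.  A negative
  bound can be replaced by 0, since no set has negative weight.
\<close>

lemma linearly_separable_complement:
  assumes fin: "finite V"
  shows "linearly_separable V P \<longleftrightarrow>
     (\<exists>(w :: 'a \<Rightarrow> real) (t :: real).
        (\<forall>v \<in> V. 0 \<le> w v) \<and> 0 \<le> t \<and> (\<forall>S \<subseteq> V. (\<Sum>x\<in>S. w x) \<ge> t \<longleftrightarrow> \<not> P (V - S)))"
    (is "_ \<longleftrightarrow> ?dual")
proof
  assume "linearly_separable V P"
  then obtain w :: "'a \<Rightarrow> real" and t where w: "\<forall>v \<in> V. 0 \<le> w v"
    and t: "\<forall>X \<subseteq> V. (\<Sum>x\<in>X. w x) \<le> t \<longleftrightarrow> \<not> P X"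
    unfolding linearly_separable_def by blast
  let ?t = "max 0 ((\<Sum>x\<in>V. w x) - t)"
  have "(\<Sum>x\<in>S. w x) \<ge> ?t \<longleftrightarrow> \<not> P (V - S)" if S: "S \<subseteq> V" for S
  proof -
    have "(\<Sum>x\<in>V - S. w x) = (\<Sum>x\<in>V. w x) - (\<Sum>x\<in>S. w x)"
      using S by (rule sum_diff[OF fin])
    moreover have "0 \<le> (\<Sum>x\<in>S. w x)"
      using w S by (intro sum_nonneg) auto
    moreover have "(\<Sum>x\<in>V - S. w x) \<le> t \<longleftrightarrow> \<not> P (V - S)"
      using t by auto
    ultimately show ?thesis by auto
  qed
  then show ?dual using w by (intro exI[of _ w] exI[of _ ?t]) auto
next
  assume ?dual
  then obtain w :: "'a \<Rightarrow> real" and t where w: "\<forall>v \<in> V. 0 \<le> w v"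
    and t: "\<forall>S \<subseteq> V. (\<Sum>x\<in>S. w x) \<ge> t \<longleftrightarrow> \<not> P (V - S)"
    by blast
  have "(\<Sum>x\<in>X. w x) \<le> (\<Sum>x\<in>V. w x) - t \<longleftrightarrow> \<not> P X" if X: "X \<subseteq> V" for X
  proof -
    have "(\<Sum>x\<in>V - X. w x) = (\<Sum>x\<in>V. w x) - (\<Sum>x\<in>X. w x)"
      using X by (rule sum_diff[OF fin])
    moreover have "(\<Sum>x\<in>V - X. w x) \<ge> t \<longleftrightarrow> \<not> P X"
      using t X by (metis Diff_subset double_diff order_refl)
    ultimately show ?thesis by auto
  qed
  then show "linearly_separable V P"
    unfolding linearly_separable_def using w by blast
qed

section \<open>Total domishold graphs, threshold functions and threshold hypergraphs\<close>

lemma total_domishold_iff_separable: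
  assumes "finite (pverts G)"
  shows "total_domishold G \<longleftrightarrow>
    linearly_separable (pverts G) (\<lambda>X. \<exists>v \<in> pverts G. neighborhood G v \<subseteq> X)"
proof -
  have "total_dominating_set G S \<longleftrightarrow> \<not> (\<exists>v \<in> pverts G. neighborhood G v \<subseteq> pverts G - S)"
    if "S \<subseteq> pverts G" for S
    using that unfolding total_dominating_set_def neighborhood_def by blast
  then show ?thesis
    unfolding total_domishold_def linearly_separable_complement[OF assms] by (simp cong: conj_cong)
qed

lemma threshold_hypergraph_iff_separable:
  "threshold_hypergraph (V, E) \<longleftrightarrow> linearly_separable V (\<lambda>X. \<exists>e \<in># E. e \<subseteq> X)"
  by (simp add: threshold_hypergraph_def linearly_separable_def)

text \<open>
  The points of the cube are the characteristic functions of the subsets of \<open>V\<close>, and \<open>restrict\<close>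
  makes them extensional.
\<close>

lemma threshold_fun_iff_separable:
  assumes fin: "finite V" and pos: "positive_fun V f"
  shows "threshold_fun V f \<longleftrightarrow> linearly_separable V (\<lambda>X. f (\<lambda>v\<in>V. v \<in> X))"
proof -
  have cube: "bool_cube V = (\<lambda>X. \<lambda>v\<in>V. v \<in> X) ` Pow V"
  proof (intro equalityI subsetI)
    fix x assume "x \<in> bool_cube V"
    then have "x = (\<lambda>v\<in>V. v \<in> {v \<in> V. x v})"
      by (auto simp: bool_cube_def fun_eq_iff PiE_def extensional_def)
    then show "x \<in> (\<lambda>X. \<lambda>v\<in>V. v \<in> X) ` Pow V"
      by (intro image_eqI[of _ _ "{v \<in> V. x v}"]) auto
  qed (auto simp: bool_cube_def)
  have weight: "(\<Sum>v\<in>V. w v * of_bool ((\<lambda>v\<in>V. v \<in> X) v)) = (\<Sum>v\<in>X. w v)"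
    if "X \<subseteq> V" for w :: "'a \<Rightarrow> real" and X
    using that by (intro sum.mono_neutral_cong_right fin) auto
  have "(\<forall>x \<in> bool_cube V. \<not> f x \<longleftrightarrow> (\<Sum>v\<in>V. w v * of_bool (x v)) \<le> t) \<longleftrightarrow>
        (\<forall>X \<subseteq> V. (\<Sum>v\<in>X. w v) \<le> t \<longleftrightarrow> \<not> f (\<lambda>v\<in>V. v \<in> X))" for w :: "'a \<Rightarrow> real" and t
    unfolding cube using weight[of _ w] by (auto simp del: restrict_apply)
  then show ?thesis
    using pos unfolding threshold_fun_def linearly_separable_def by simp
qed

section \<open>Reduction to prime implicants and to minimal neighborhoods\<close>

text \<open>
  Take an inclusion-minimal implicant below the given one.
\<close>

lemma implicant_contains_prime:
  assumes "finite V" and "implicant V f C"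
  obtains D where "D \<subseteq> C" and "prime_implicant V f D"
proof -
  have "finite {D. implicant V f D}"
    by (rule finite_subset[of _ "Pow V"]) (use assms(1) in \<open>auto simp: implicant_def\<close>)
  then obtain D where "implicant V f D" "D \<subseteq> C" "\<And>E. implicant V f E \<Longrightarrow> E \<subseteq> D \<Longrightarrow> D = E"
    using finite_has_minimal2[of "{D. implicant V f D}" C] assms(2) by auto
  then show thesis
    using that unfolding prime_implicant_def by blast
qed

text \<open>
  The support of a true point of a positive function is an implicant, so the prime implicants
  recover the function.
\<close>

lemma dnf_fun_complete_dnf:
  assumes fin: "finite V" and pos: "positive_fun V f" and x: "x \<in> bool_cube V"
  shows "dnf_fun (complete_dnf V f) x \<longleftrightarrow> f x"
proof
  assume "dnf_fun (complete_dnf V f) x"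
  then obtain C where "prime_implicant V f C" "\<forall>i \<in> C. x i"
    using finite_prime_implicants[OF fin, of f] by (auto simp: dnf_fun_def complete_dnf_def)
  then show "f x"
    using x by (auto simp: prime_implicant_def implicant_def)
next
  assume fx: "f x"
  have "implicant V f {v \<in> V. x v}"
    using pos x fx unfolding implicant_def positive_fun_def by (fastforce simp: le_bool_def)
  then obtain D where "D \<subseteq> {v \<in> V. x v}" "prime_implicant V f D"
    using implicant_contains_prime[OF fin] by blast
  then show "dnf_fun (complete_dnf V f) x"
    using finite_prime_implicants[OF fin, of f] by (auto simp: dnf_fun_def complete_dnf_def)
qed

lemma positive_dnf_fun:
  assumes "\<And>C. C \<in># \<phi> \<Longrightarrow> C \<subseteq> V"
  shows "positive_fun V (dnf_fun \<phi>)"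
  using assms unfolding positive_fun_def dnf_fun_def le_bool_def by blast

lemma dnf_fun_characteristic:
  assumes "\<And>C. C \<in># \<phi> \<Longrightarrow> C \<subseteq> V"
  shows "dnf_fun \<phi> (\<lambda>v\<in>V. v \<in> X) \<longleftrightarrow> (\<exists>C \<in># \<phi>. C \<subseteq> X)"
  using assms unfolding dnf_fun_def by (auto simp: subset_iff)

lemma neighborhood_fun_characteristic:
  "neighborhood_fun G (\<lambda>v\<in>pverts G. v \<in> X) \<longleftrightarrow> (\<exists>v \<in> pverts G. neighborhood G v \<subseteq> X)"
  unfolding neighborhood_fun_def by (auto simp: neighborhood_def subset_iff)

lemma contains_minimal_neighborhood:
  assumes "finite (pverts G)" and "v \<in> pverts G"
  obtains e where "e \<in> minimal_neighborhoods G" and "e \<subseteq> neighborhood G v"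
proof -
  obtain e where e: "e \<in> neighborhood G ` pverts G" "e \<subseteq> neighborhood G v"
    and least: "\<forall>d \<in> neighborhood G ` pverts G. d \<subseteq> e \<longrightarrow> e = d"
    using finite_has_minimal2[OF finite_imageI[OF assms(1)]
        imageI[OF assms(2), of "neighborhood G"]] by blast
  from e(1) obtain u where u: "u \<in> pverts G" "e = neighborhood G u" by blast
  have "\<not> neighborhood G w \<subset> neighborhood G u" if "w \<in> pverts G" for w
    using least that u(2) by auto
  with u have "e \<in> minimal_neighborhoods G"
    unfolding minimal_neighborhoods_def by auto
  with e(2) show thesis by (intro that)
qed

lemma contains_minimal_neighborhood_iff:
  assumes "finite (pverts G)"
  shows "(\<exists>e \<in> minimal_neighborhoods G. e \<subseteq> X) \<longleftrightarrow> (\<exists>v \<in> pverts G. neighborhood G v \<subseteq> X)"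
proof
  assume "\<exists>e \<in> minimal_neighborhoods G. e \<subseteq> X"
  then show "\<exists>v \<in> pverts G. neighborhood G v \<subseteq> X"
    by (auto simp: minimal_neighborhoods_def)
next
  assume "\<exists>v \<in> pverts G. neighborhood G v \<subseteq> X"
  then show "\<exists>e \<in> minimal_neighborhoods G. e \<subseteq> X"
    using contains_minimal_neighborhood[OF assms] by (metis subset_trans)
qed

text \<open>
  A graph has no loops, so a minimal neighborhood inside \<open>neighborhood G v\<close> misses \<open>v\<close>.
\<close>

lemma minimal_neighborhood_missing_vertex:
  assumes "pair_graph G" and "v \<in> pverts G"
  shows "\<exists>e \<in> minimal_neighborhoods G. v \<notin> e"
proof -
  interpret pair_graph G by fact
  have "v \<notin> neighborhood G v"
    using pair_no_loops[of "(v, v)"] by (auto simp: neighborhood_def)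
  then show ?thesis
    using contains_minimal_neighborhood[OF pair_finite_verts assms(2)] by (metis subsetD)
qed

section \<open>Total domination in split graphs\<close>

text \<open>
  A clique vertex \<open>v\<close> is dominated for free: some independent vertex \<open>y\<close> is not adjacent to \<open>v\<close>, and
  the clique vertex that dominates \<open>y\<close> differs from \<open>v\<close>, hence is adjacent to \<open>v\<close>.
\<close>

lemma total_dominating_split_graph:
  assumes miss: "\<And>v. v \<in> K \<Longrightarrow> \<exists>y \<in> I. \<not> adj v y"
    and S: "S \<subseteq> Inl ` K \<union> Inr ` I"
  shows "total_dominating_set (split_graph_of K I adj) S \<longleftrightarrow>
    (\<forall>y \<in> I. \<exists>u \<in> K. Inl u \<in> S \<and> adj u y)"
proof
  assume "total_dominating_set (split_graph_of K I adj) S"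
  then show "\<forall>y \<in> I. \<exists>u \<in> K. Inl u \<in> S \<and> adj u y"
    unfolding total_dominating_set_def neighborhood_def split_graph_of_def by auto
next
  assume hit: "\<forall>y \<in> I. \<exists>u \<in> K. Inl u \<in> S \<and> adj u y"
  have "\<exists>u \<in> K. Inl u \<in> S \<and> u \<noteq> v" if "v \<in> K" for v
    using miss[OF that] hit by metis
  with hit S show "total_dominating_set (split_graph_of K I adj) S"
    unfolding total_dominating_set_def neighborhood_def split_graph_of_def by fastforce
qed

text \<open>
  By the previous lemma, independent vertices never help a set to be totally dominating, so they
  may be given weight 0.
\<close>

lemma total_domishold_split_graph:
  assumes fin: "finite K" "finite I"
    and miss: "\<And>v. v \<in> K \<Longrightarrow> \<exists>y \<in> I. \<not> adj v y"
  shows "total_domishold (split_graph_of K I adj) \<longleftrightarrow>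
    linearly_separable K (\<lambda>X. \<exists>y \<in> I. {v \<in> K. adj v y} \<subseteq> X)"
    (is "?domishold \<longleftrightarrow> linearly_separable K ?P")
proof -
  let ?S = "split_graph_of K I adj"
  have verts: "pverts ?S = Inl ` K \<union> Inr ` I"
    by (simp add: split_graph_of_def)
  have dom: "total_dominating_set ?S S \<longleftrightarrow> \<not> ?P (K - Inl -` S)" if "S \<subseteq> pverts ?S" for S
    using that unfolding verts by (subst total_dominating_split_graph[OF miss]) auto
  show ?thesis
  proof
    assume ?domishold
    then obtain w :: "'a + 'b \<Rightarrow> real" and t where w: "\<forall>v \<in> pverts ?S. 0 \<le> w v" and "0 \<le> t"
      and t: "\<forall>S \<subseteq> pverts ?S. (\<Sum>x\<in>S. w x) \<ge> t \<longleftrightarrow> total_dominating_set ?S S"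
      unfolding total_domishold_def by blast
    have "(\<Sum>x\<in>X. w (Inl x)) \<ge> t \<longleftrightarrow> \<not> ?P (K - X)" if "X \<subseteq> K" for X
    proof -
      have sub: "Inl ` X \<subseteq> pverts ?S" using that by (auto simp: verts)
      have "(\<Sum>x\<in>X. w (Inl x)) = (\<Sum>x\<in>Inl ` X. w x)" by (simp add: sum.reindex)
      also have "\<dots> \<ge> t \<longleftrightarrow> \<not> ?P (K - Inl -` Inl ` X)"
        using t sub dom[OF sub] by blast
      also have "Inl -` Inl ` X = X" by (simp add: inj_vimage_image_eq)
      finally show ?thesis .
    qed
    then show "linearly_separable K ?P"
      unfolding linearly_separable_complement[OF fin(1)] using w \<open>0 \<le> t\<close>
      by (intro exI[of _ "\<lambda>x. w (Inl x)"] exI[of _ t]) (auto simp: verts)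
  next
    assume "linearly_separable K ?P"
    then obtain w :: "'a \<Rightarrow> real" and t where w: "\<forall>v \<in> K. 0 \<le> w v" and "0 \<le> t"
      and t: "\<forall>X \<subseteq> K. (\<Sum>x\<in>X. w x) \<ge> t \<longleftrightarrow> \<not> ?P (K - X)"
      unfolding linearly_separable_complement[OF fin(1)] by blast
    define w' :: "'a + 'b \<Rightarrow> real" where "w' = case_sum w (\<lambda>_. 0)"
    have "(\<Sum>x\<in>S. w' x) \<ge> t \<longleftrightarrow> total_dominating_set ?S S" if S: "S \<subseteq> pverts ?S" for S
    proof -
      have "finite S" using S fin by (auto simp: verts intro: finite_subset)
      then have "(\<Sum>x\<in>S. w' x) = (\<Sum>x\<in>Inl ` (Inl -` S). w' x)"
        by (intro sum.mono_neutral_right) (auto simp: w'_def split: sum.split)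
      also have "\<dots> = (\<Sum>x\<in>Inl -` S. w x)"
        by (subst sum.reindex) (auto simp: w'_def)
      finally have weight: "(\<Sum>x\<in>S. w' x) = (\<Sum>x\<in>Inl -` S. w x)" .
      have sub: "Inl -` S \<subseteq> K" using S by (auto simp: verts)
      show ?thesis unfolding weight dom[OF S] using t sub by blast
    qed
    then show ?domishold
      unfolding total_domishold_def using w \<open>0 \<le> t\<close>
      by (intro exI[of _ w'] exI[of _ t]) (auto simp: verts w'_def)
  qed
qed

section \<open>The equivalence\<close>

theorem theorem4p5:
  fixes G :: "'a pair_pre_digraph"
  assumes "pair_graph G"
  defines "\<phi> \<equiv> complete_dnf (pverts G) (neighborhood_fun G)"
  shows "(total_domishold G
            \<longleftrightarrow> threshold_fun (pverts G) (neighborhood_fun G))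
       \<and> (threshold_fun (pverts G) (neighborhood_fun G)
            \<longleftrightarrow> threshold_fun (pverts G) (dnf_fun \<phi>))
       \<and> (threshold_fun (pverts G) (dnf_fun \<phi>)
            \<longleftrightarrow> threshold_hypergraph (dnf_hypergraph (pverts G) \<phi>))
       \<and> (threshold_hypergraph (dnf_hypergraph (pverts G) \<phi>)
            \<longleftrightarrow> threshold_hypergraph (reduced_neighborhood_hypergraph G))
       \<and> (threshold_hypergraph (reduced_neighborhood_hypergraph G)
            \<longleftrightarrow> total_domishold (split_incidence_graph (reduced_neighborhood_hypergraph G)))
       \<and> (total_domishold (split_incidence_graph (reduced_neighborhood_hypergraph G))
            \<longleftrightarrow> total_domishold (neighborhood_split_graph G))"
proof -
  interpret pair_graph G by fact
  let ?V = "pverts G"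
  have fin: "finite ?V" by (rule pair_finite_verts)
  let ?U = "linearly_separable ?V (\<lambda>X. \<exists>v \<in> ?V. neighborhood G v \<subseteq> X)"
  note pos = positive_neighborhood_fun[of G]
  note finM = finite_minimal_neighborhoods[OF assms(1)]
  note min_iff = contains_minimal_neighborhood_iff[OF fin]
  have minV: "e \<subseteq> ?V" if "e \<in> minimal_neighborhoods G" for e
    using that by (auto simp: minimal_neighborhoods_def neighborhood_def)
  have \<phi>V: "C \<subseteq> ?V" if "C \<in># \<phi>" for C
    using that finite_prime_implicants[OF fin]
    by (auto simp: \<phi>_def complete_dnf_def prime_implicant_def implicant_def)
  have \<phi>_iff: "(\<exists>C \<in># \<phi>. C \<subseteq> X) \<longleftrightarrow> (\<exists>v \<in> ?V. neighborhood G v \<subseteq> X)" for X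
  proof -
    have "(\<lambda>v\<in>?V. v \<in> X) \<in> bool_cube ?V" by (auto simp: bool_cube_def)
    then show ?thesis
      using dnf_fun_complete_dnf[OF fin pos, folded \<phi>_def] dnf_fun_characteristic[of \<phi>, OF \<phi>V]
        neighborhood_fun_characteristic[of G X]
      by metis
  qed

  have i: "total_domishold G \<longleftrightarrow> ?U"
    by (rule total_domishold_iff_separable[OF fin])
  have ii: "threshold_fun ?V (neighborhood_fun G) \<longleftrightarrow> ?U"
    by (simp add: threshold_fun_iff_separable[OF fin pos] neighborhood_fun_characteristic)
  have iii: "threshold_fun ?V (dnf_fun \<phi>) \<longleftrightarrow> ?U"
    by (simp add: threshold_fun_iff_separable[OF fin positive_dnf_fun[of \<phi>, OF \<phi>V]]
        dnf_fun_characteristic[of \<phi>, OF \<phi>V] \<phi>_iff)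
  have iv: "threshold_hypergraph (dnf_hypergraph ?V \<phi>) \<longleftrightarrow> ?U"
    by (simp add: dnf_hypergraph_def threshold_hypergraph_iff_separable \<phi>_iff)
  have v: "threshold_hypergraph (reduced_neighborhood_hypergraph G) \<longleftrightarrow> ?U"
    using finM
    by (simp add: reduced_neighborhood_hypergraph_def threshold_hypergraph_iff_separable min_iff)

  have nbrs: "{u \<in> ?V. u \<in> e} = e" if "e \<in> minimal_neighborhoods G" for e
    using minV[OF that] by blast
  have vii: "total_domishold (neighborhood_split_graph G) \<longleftrightarrow> ?U"
    unfolding neighborhood_split_graph_def
    using total_domishold_split_graph[OF fin finM, of "(\<in>)"]
      minimal_neighborhood_missing_vertex[OF assms(1)]
    by (simp add: nbrs min_iff cong: bex_cong)

  \<comment> \<open>The minimal neighborhoods form a set, so each hyperedge has multiplicity 1 and gives the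
    single independent vertex \<open>(e, 0)\<close>.\<close>
  have "{(e, i). i < count (mset_set (minimal_neighborhoods G)) e} = minimal_neighborhoods G \<times> {0}"
    using finM by (auto simp: count_mset_set' split: if_splits)
  then have SI: "split_incidence_graph (reduced_neighborhood_hypergraph G) =
      split_graph_of ?V (minimal_neighborhoods G \<times> {0}) (\<lambda>v (e, i). v \<in> e)"
    by (simp add: split_incidence_graph_def reduced_neighborhood_hypergraph_def)
  have vi: "total_domishold (split_incidence_graph (reduced_neighborhood_hypergraph G)) \<longleftrightarrow> ?U"
    unfolding SI
    using total_domishold_split_graph[OF fin finite_cartesian_product[OF finM],
        of "{0}" "\<lambda>v (e, i). v \<in> e"] minimal_neighborhood_missing_vertex[OF assms(1)]
    by (simp add: nbrs min_iff cong: bex_cong)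

  show ?thesis by (simp only: i ii iii iv v vi vii simp_thms)
qed

end
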